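(* For every $N$ there exist $n\geq N$ and $n$-tuples $P,P'\in(\mathbb{R}^2)^n$ of the same order type such that \[ \operatorname{dist}(P,P')\geq 10^{-4}\binom{n}{3}. \]
   Context: For points $p_0,p_1,p_2\in\mathbb{R}^2$, their orientation is the sign ($-1,0,+1$) of the $3\times 3$ determinant with first row $(1,1,1)$ and columns below it the coordinates of $p_0,p_1,p_2$. The order type of $P=(p_1,\dots,p_n)$ is the function assigning to each triple $i<j<k$ the orientation of $(p_i,p_j,p_k)$. A tuple is in general position if no three of its points are collinear. A motion between $P,P'\in(\mathbb{R}^2)^n$ is a continuous $m\colon[0,1]\to(\mathbb{R}^2)^n$ with $m(0)=P$, $m(1)=P'$, such that $m(t)$ fails to be in general position for only finitely many $t$, and at each such $t$ exactly one triple of points of $m(t)$ is collinear; its cost is the number of such times. $\operatorname{dist}(P,P')$ is the minimum cost of a motion from $P$ to $P'$. *)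

theory Defs
  imports "HOL-Analysis.Analysis"
begin

text \<open>
  An \<open>n\<close>-tuple of points in the plane is represented by a function \<open>P :: nat \<Rightarrow> real ^ 2\<close> of which
  only the values \<open>P 0, \<dots>, P (n - 1)\<close> are relevant; all notions below ignore the other values.
\<close>

definition triples :: "nat \<Rightarrow> (nat \<times> nat \<times> nat) set" where
  "triples n = {(i, j, k). i < j \<and> j < k \<and> k < n}"

definition orientation :: "real ^ 2 \<Rightarrow> real ^ 2 \<Rightarrow> real ^ 2 \<Rightarrow> real" where
  "orientation p q r =
     sgn (det (vector [vector [1, 1, 1],
                       vector [p $ 1, q $ 1, r $ 1],
                       vector [p $ 2, q $ 2, r $ 2]] :: real ^ 3 ^ 3))"

definition order_type :: "nat \<Rightarrow> (nat \<Rightarrow> real ^ 2) \<Rightarrow> nat \<times> nat \<times> nat \<Rightarrow> real" where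
  "order_type n P = restrict (\<lambda>(i, j, k). orientation (P i) (P j) (P k)) (triples n)"

definition collinear_triples :: "nat \<Rightarrow> (nat \<Rightarrow> real ^ 2) \<Rightarrow> (nat \<times> nat \<times> nat) set" where
  "collinear_triples n P = {(i, j, k) \<in> triples n. collinear {P i, P j, P k}}"

definition general_position :: "nat \<Rightarrow> (nat \<Rightarrow> real ^ 2) \<Rightarrow> bool" where
  "general_position n P \<longleftrightarrow> (\<forall>(i, j, k) \<in> triples n. \<not> collinear {P i, P j, P k})"

definition degenerate_times :: "nat \<Rightarrow> (real \<Rightarrow> nat \<Rightarrow> real ^ 2) \<Rightarrow> real set" where
  "degenerate_times n m = {t \<in> {0..1}. \<not> general_position n (m t)}"

definition motion ::
    "nat \<Rightarrow> (nat \<Rightarrow> real ^ 2) \<Rightarrow> (nat \<Rightarrow> real ^ 2) \<Rightarrow> (real \<Rightarrow> nat \<Rightarrow> real ^ 2) \<Rightarrow> bool" where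
  "motion n P P' m \<longleftrightarrow>
     (\<forall>i<n. continuous_on {0..1} (\<lambda>t. m t i)) \<and>
     (\<forall>i<n. m 0 i = P i) \<and> (\<forall>i<n. m 1 i = P' i) \<and>
     finite (degenerate_times n m) \<and>
     (\<forall>t \<in> degenerate_times n m. card (collinear_triples n (m t)) = 1)"

definition motion_cost :: "nat \<Rightarrow> (real \<Rightarrow> nat \<Rightarrow> real ^ 2) \<Rightarrow> nat" where
  "motion_cost n m = card (degenerate_times n m)"

text \<open>
  In \<^typ>\<open>enat\<close> the infimum of a nonempty set is its minimum; it is \<open>\<infinity>\<close> if there is no motion
  (which never happens between tuples in general position).
\<close>

definition motion_dist :: "nat \<Rightarrow> (nat \<Rightarrow> real ^ 2) \<Rightarrow> (nat \<Rightarrow> real ^ 2) \<Rightarrow> enat" where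
  "motion_dist n P P' = Inf {enat (motion_cost n m) | m. motion n P P' m}"

end

theory Submission
  imports Defs
begin

text \<open>
  There are two configurations of 16 points with the same order type that lie in different
  components of its realization space. In the projective chart that sends points 1 and 2 to
  infinity, the order type confines point \<open>(s, t)\<close> to the region \<open>s/d\<^sub>1 + t/d\<^sub>2 > 1\<close>, while a chain
  of orientations gives \<open>4 * s * t < d\<^sub>1 * d\<^sub>2\<close>; hence \<open>s/d\<^sub>1 \<noteq> t/d\<^sub>2\<close>, and both signs of the difference
  occur. Replace every point by a cluster of \<open>k\<close> points. Each of the \<open>k^16\<close> transversals of the
  clusters makes some triple collinear during any motion, and a collinear triple belongs to at
  most \<open>k^13\<close> transversals, so at least \<open>k^3\<close> times are degenerate.
\<close>

section \<open>Orientations as signed areas\<close>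

definition area :: "real ^ 2 \<Rightarrow> real ^ 2 \<Rightarrow> real ^ 2 \<Rightarrow> real" where
  "area p q r = (q $ 1 - p $ 1) * (r $ 2 - p $ 2) - (q $ 2 - p $ 2) * (r $ 1 - p $ 1)"

lemma orientation_eq_sgn_area: "orientation p q r = sgn (area p q r)"
  unfolding orientation_def area_def
  by (rule arg_cong[where f = sgn]) (simp add: det_3 vector_3 algebra_simps)

lemma collinear_iff_area: "collinear {p, q, r} \<longleftrightarrow> area p q r = 0"
proof
  assume "collinear {p, q, r}"
  then obtain u where u: "\<And>x y. x \<in> {p, q, r} \<Longrightarrow> y \<in> {p, q, r} \<Longrightarrow> \<exists>c. x - y = c *\<^sub>R u"
    unfolding collinear_def by blast
  obtain c d where "q - p = c *\<^sub>R u" "r - p = d *\<^sub>R u"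
    using u[of q p] u[of r p] by auto
  then have "q $ i - p $ i = c * u $ i" "r $ i - p $ i = d * u $ i" for i
    by (metis vector_minus_component vector_scaleR_component real_scaleR_def)+
  then show "area p q r = 0" by (simp add: area_def)
next
  assume z: "area p q r = 0"
  show "collinear {p, q, r}"
  proof (cases "q = p")
    case True
    then show ?thesis by simp
  next
    case False
    then have ne: "q $ 1 \<noteq> p $ 1 \<or> q $ 2 \<noteq> p $ 2"
      by (metis (full_types) exhaust_2 vec_eq_iff)
    define c where "c = (if q $ 1 \<noteq> p $ 1 then (r $ 1 - p $ 1) / (q $ 1 - p $ 1)
                         else (r $ 2 - p $ 2) / (q $ 2 - p $ 2))"
    have "r $ 1 - p $ 1 = c * (q $ 1 - p $ 1) \<and> r $ 2 - p $ 2 = c * (q $ 2 - p $ 2)"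
      using z ne by (auto simp: c_def area_def field_simps)
    then have "r - p = c *\<^sub>R (q - p)"
      by (simp add: vec_eq_iff forall_2)
    then have "collinear {q, p, r}"
      by (auto simp: collinear_3[of q p r] collinear_lemma)
    then show ?thesis by (simp add: insert_commute)
  qed
qed

text \<open>Up to the factor \<open>area Z X Y\<close>, the values \<open>z p\<close>,
  \<open>x p\<close>, \<open>y p\<close> are the barycentric coordinates of \<open>p\<close> in the
  triangle \<open>Z X Y\<close>. The last identity is the change of basis for the 3 by 3
  determinant; the first three are its cases where one point is a vertex, with a common factor
  cancelled.\<close>

lemma area_barycentric:
  fixes Z X Y :: "real ^ 2"
  defines "z \<equiv> area X Y" and "x \<equiv> area Y Z" and "y \<equiv> area Z X"
  shows "area Z X Y * area X u v = y u * z v - z u * y v"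
    and "area Z X Y * area Y u v = z u * x v - x u * z v"
    and "area Z X Y * area Z u v = x u * y v - y u * x v"
    and "(area Z X Y)\<^sup>2 * area u v w =
      z u * (x v * y w - y v * x w) - x u * (z v * y w - y v * z w) + y u * (z v * x w - x v * z w)"
proof -
  show "area Z X Y * area X u v = y u * z v - z u * y v"
    and "area Z X Y * area Y u v = z u * x v - x u * z v"
    unfolding assms area_def by (simp_all add: algebra_simps)
  show Z: "area Z X Y * area Z u v = x u * y v - y u * x v" for u v
    unfolding assms area_def by (simp add: algebra_simps)
  have sum: "area Z X Y = z p + x p + y p" for p
    unfolding assms area_def by (simp add: algebra_simps)
  have "area u v w = area Z u v + area Z v w - area Z u w"
    unfolding area_def by (simp add: algebra_simps)
  then have "(area Z X Y)\<^sup>2 * area u v w = area Z X Y * (area Z X Y * area Z u v)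
      + area Z X Y * (area Z X Y * area Z v w) - area Z X Y * (area Z X Y * area Z u w)"
    by (simp add: power2_eq_square ring_distribs)
  also have "\<dots> = area Z X Y * (x u * y v - y u * x v)
      + area Z X Y * (x v * y w - y v * x w) - area Z X Y * (x u * y w - y u * x w)"
    by (simp only: Z)
  also have "\<dots> = (z w + x w + y w) * (x u * y v - y u * x v)
      + (z u + x u + y u) * (x v * y w - y v * x w) - (z v + x v + y v) * (x u * y w - y u * x w)"
    by (simp only: sum[of u, symmetric] sum[of v, symmetric] sum[of w, symmetric])
  finally show "(area Z X Y)\<^sup>2 * area u v w =
      z u * (x v * y w - y v * x w) - x u * (z v * y w - y v * z w) + y u * (z v * x w - x v * z w)"
    by (simp add: algebra_simps)
qed

text \<open>
  The chain is \<open>4*s*t < 4*a*b < 4*g\<^sub>1*g\<^sub>2 < h\<^sub>1*h\<^sub>2 < d\<^sub>1*d\<^sub>2\<close>; its third step is the AM-GM inequality for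
  \<open>g\<^sub>1/h\<^sub>1 + g\<^sub>2/h\<^sub>2 < 1\<close>. The variables \<open>v\<^sub>1, v\<^sub>2, w\<^sub>1, w\<^sub>2\<close> perturb points off the coordinate axes.
\<close>

lemma chart_obstruction:
  fixes s t d\<^sub>1 d\<^sub>2 :: real
  assumes pos: "0 < s" "0 < t" "0 < a" "0 < b" "0 < e\<^sub>1" "0 < e\<^sub>2" "0 < f\<^sub>1" "0 < f\<^sub>2"
      "0 < c\<^sub>1" "0 < c\<^sub>2" "0 < c\<^sub>1'" "0 < c\<^sub>2'" "0 < g\<^sub>1" "0 < g\<^sub>2" "0 < h\<^sub>1" "0 < h\<^sub>2" "0 < v\<^sub>1" "0 < v\<^sub>2"
      "0 < d\<^sub>1" "0 < d\<^sub>2" "0 < w\<^sub>1" "0 < w\<^sub>2" "0 < j\<^sub>1" "0 < j\<^sub>2" "0 < k\<^sub>1" "0 < k\<^sub>2"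
    and EF: "t < e\<^sub>2" "s < f\<^sub>1" "e\<^sub>1 < a" "f\<^sub>2 < b" "f\<^sub>1 * e\<^sub>2 < e\<^sub>1 * f\<^sub>2"
    and C: "b < c\<^sub>2" "c\<^sub>1 < g\<^sub>1" "a < c\<^sub>1'" "c\<^sub>2' < g\<^sub>2" "c\<^sub>1' * c\<^sub>2 < c\<^sub>1 * c\<^sub>2'"
    and GH: "(v\<^sub>2 + h\<^sub>1) * (- g\<^sub>2 - v\<^sub>1) + (h\<^sub>2 + v\<^sub>1) * (h\<^sub>1 - g\<^sub>1) > 0"
    and JK: "h\<^sub>1 < j\<^sub>1" "j\<^sub>2 < d\<^sub>2" "k\<^sub>1 < d\<^sub>1" "h\<^sub>2 < k\<^sub>2" "j\<^sub>1 * k\<^sub>2 < k\<^sub>1 * j\<^sub>2"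
    and D: "w\<^sub>2 < d\<^sub>1" "w\<^sub>1 < d\<^sub>2"
    and pD: "(w\<^sub>2 - d\<^sub>1) * (t - w\<^sub>1) - (d\<^sub>2 - w\<^sub>1) * (s - d\<^sub>1) < 0"
  shows "s * d\<^sub>2 \<noteq> t * d\<^sub>1"
proof
  assume eq: "s * d\<^sub>2 = t * d\<^sub>1"
  have prod: "x * y < x' * y'" if "0 < x" "0 < y" "x < x'" "y < y'" for x y x' y' :: real
    using that by (intro mult_strict_mono) auto
  have "s * t < f\<^sub>1 * e\<^sub>2" "e\<^sub>1 * f\<^sub>2 < a * b" "a * b < c\<^sub>1' * c\<^sub>2" "c\<^sub>1 * c\<^sub>2' < g\<^sub>1 * g\<^sub>2"
    "h\<^sub>1 * h\<^sub>2 < j\<^sub>1 * k\<^sub>2" "k\<^sub>1 * j\<^sub>2 < d\<^sub>1 * d\<^sub>2"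
    using pos EF C JK by (auto intro!: prod)
  \<comment> \<open>The cross-product inequalities in \<open>EF\<close>, \<open>C\<close> and
    \<open>JK\<close> link the monotone steps into two chains; only the link from \<open>g\<close>
    to \<open>h\<close> is still missing.\<close>
  then have st: "s * t < g\<^sub>1 * g\<^sub>2" and hd: "h\<^sub>1 * h\<^sub>2 < d\<^sub>1 * d\<^sub>2"
    using EF C JK by linarith+
  \<comment> \<open>Expanding \<open>GH\<close> cancels \<open>h\<^sub>1 * v\<^sub>1\<close>. Every
    remaining term with a perturbation is negative, so dropping these terms keeps the
    inequality.\<close>
  have "h\<^sub>1 * g\<^sub>2 + h\<^sub>2 * g\<^sub>1 < h\<^sub>1 * h\<^sub>2"
  proof -
    have "0 < v\<^sub>2 * g\<^sub>2" "0 < v\<^sub>2 * v\<^sub>1" "0 < v\<^sub>1 * g\<^sub>1" using pos by simp_all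
    with GH show ?thesis by (simp add: algebra_simps)
  qed
  then have "(h\<^sub>1 * g\<^sub>2 + h\<^sub>2 * g\<^sub>1)\<^sup>2 < (h\<^sub>1 * h\<^sub>2)\<^sup>2"
    using pos by (intro power_strict_mono) auto
  moreover have "4 * ((h\<^sub>1 * g\<^sub>2) * (h\<^sub>2 * g\<^sub>1)) \<le> (h\<^sub>1 * g\<^sub>2 + h\<^sub>2 * g\<^sub>1)\<^sup>2"
    using zero_le_power2[of "h\<^sub>1 * g\<^sub>2 - h\<^sub>2 * g\<^sub>1"] by (simp add: power2_eq_square algebra_simps)
  ultimately have "(h\<^sub>1 * h\<^sub>2) * (4 * (g\<^sub>1 * g\<^sub>2)) < (h\<^sub>1 * h\<^sub>2) * (h\<^sub>1 * h\<^sub>2)"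
    by (simp add: power2_eq_square algebra_simps)
  then have gh: "4 * (g\<^sub>1 * g\<^sub>2) < h\<^sub>1 * h\<^sub>2"
    using pos by (simp add: mult_less_cancel_left_pos)
  \<comment> \<open>By \<open>eq\<close> the ratios \<open>s/d\<^sub>1\<close> and
    \<open>t/d\<^sub>2\<close> agree. If the common value were at most 1/2, then twice the left side
    of \<open>pD\<close> would be at least \<open>w\<^sub>2 * d\<^sub>2 + w\<^sub>1 * d\<^sub>1 - 2
    * w\<^sub>1 * w\<^sub>2\<close>, which is nonnegative by \<open>D\<close>.\<close>
  have "d\<^sub>1 < 2 * s"
  proof (rule ccontr)
    assume "\<not> d\<^sub>1 < 2 * s"
    then have s: "2 * s \<le> d\<^sub>1" by simp
    have "d\<^sub>1 * (2 * t) = 2 * s * d\<^sub>2" using eq by simp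
    also have "\<dots> \<le> d\<^sub>1 * d\<^sub>2" using s pos by (intro mult_right_mono) auto
    finally have t: "2 * t \<le> d\<^sub>2" using pos by simp
    have "(d\<^sub>1 - w\<^sub>2) * (2 * t) \<le> (d\<^sub>1 - w\<^sub>2) * d\<^sub>2" "(d\<^sub>2 - w\<^sub>1) * (2 * s) \<le> (d\<^sub>2 - w\<^sub>1) * d\<^sub>1"
      using s t D by (simp_all add: mult_left_mono)
    moreover have "w\<^sub>2 * w\<^sub>1 \<le> w\<^sub>2 * d\<^sub>2" "w\<^sub>1 * w\<^sub>2 \<le> w\<^sub>1 * d\<^sub>1"
      using pos D by (simp_all add: mult_left_mono)
    ultimately show False
      using pD by (simp add: algebra_simps)
  qed
  moreover have "d\<^sub>2 < 2 * t"
  proof -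
    have "d\<^sub>1 * d\<^sub>2 < 2 * s * d\<^sub>2" using calculation pos by simp
    also have "\<dots> = d\<^sub>1 * (2 * t)" using eq by simp
    finally show ?thesis using pos by simp
  qed
  ultimately have "d\<^sub>1 * d\<^sub>2 < (2 * s) * (2 * t)"
    using pos by (intro prod) auto
  with st hd gh show False by simp
qed

section \<open>An order type with disconnected realization space\<close>

definition iarea :: "int \<times> int \<Rightarrow> int \<times> int \<Rightarrow> int \<times> int \<Rightarrow> int" where
  "iarea p q r = (fst q - fst p) * (snd r - snd p) - (snd q - snd p) * (fst r - fst p)"

definition pt :: "int \<times> int \<Rightarrow> real ^ 2" where
  "pt p = vector [of_int (fst p), of_int (snd p)]"

lemma area_pt: "area (pt p) (pt q) (pt r) = of_int (iarea p q r)"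
  by (simp add: area_def iarea_def pt_def)

text \<open>Recursion along the list visits each increasing tuple of positions once, which turns the
  sign conditions on the explicit integer points into a finite computation.\<close>

fun all_pairs :: "('a \<Rightarrow> 'a \<Rightarrow> bool) \<Rightarrow> 'a list \<Rightarrow> bool" where
  "all_pairs P [] \<longleftrightarrow> True"
| "all_pairs P (x # xs) \<longleftrightarrow> list_all (P x) xs \<and> all_pairs P xs"

fun all_triples :: "('a \<Rightarrow> 'a \<Rightarrow> 'a \<Rightarrow> bool) \<Rightarrow> 'a list \<Rightarrow> bool" where
  "all_triples P [] \<longleftrightarrow> True"
| "all_triples P (x # xs) \<longleftrightarrow> all_pairs (P x) xs \<and> all_triples P xs"

lemma all_pairs_nth: "all_pairs P xs \<Longrightarrow> i < j \<Longrightarrow> j < length xs \<Longrightarrow> P (xs ! i) (xs ! j)"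
proof (induction xs arbitrary: i j)
  case (Cons x xs)
  obtain j' where j: "j = Suc j'"
    using Cons.prems(2) by (cases j) auto
  show ?case
  proof (cases i)
    case 0
    then show ?thesis using Cons.prems j by (simp add: list_all_length)
  next
    case (Suc i')
    then show ?thesis using Cons.prems j Cons.IH[of i' j'] by simp
  qed
qed simp

lemma all_triples_nth:
  "all_triples P xs \<Longrightarrow> i < j \<Longrightarrow> j < l \<Longrightarrow> l < length xs \<Longrightarrow> P (xs ! i) (xs ! j) (xs ! l)"
proof (induction xs arbitrary: i j l)
  case (Cons x xs)
  obtain j' where j: "j = Suc j'"
    using Cons.prems(2) by (cases j) auto
  obtain l' where l: "l = Suc l'"
    using Cons.prems(3) by (cases l) auto
  show ?case
  proof (cases i)
    case 0
    then show ?thesis using Cons.prems j l by (simp add: all_pairs_nth)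
  next
    case (Suc i')
    then show ?thesis using Cons.prems j l Cons.IH[of i' j' l'] by simp
  qed
qed simp

text \<open>
  With points 0, 1, 2 as the origin and the points at infinity of the two axes, and in the notation
  of \<open>chart_obstruction\<close>, the points 3 to 15 are near
  \<open>(s, t)\<close>, \<open>(-a, -b)\<close>, \<open>(-a, t)\<close>, \<open>(s, -b)\<close>, \<open>(-g\<^sub>1, -b)\<close>, \<open>(-a, -g\<^sub>2)\<close>, \<open>(-g\<^sub>1, -g\<^sub>2)\<close>, \<open>(-h\<^sub>1, 0)\<close>,
  \<open>(0, -h\<^sub>2)\<close>, \<open>(d\<^sub>1, 0)\<close>, \<open>(0, d\<^sub>2)\<close>, \<open>(-h\<^sub>1, d\<^sub>2)\<close>, \<open>(d\<^sub>1, -h\<^sub>2)\<close>; only points 3, 5 and 6 differ between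
  the two configurations.
\<close>

definition base_pairs :: "((int \<times> int) \<times> (int \<times> int)) list" where
  "base_pairs =
    [((0, 0), (0, 0)), ((22251, 62), (22251, 62)), ((0, 9395), (0, 9395)),
     ((221, 59), (1364, 7)), ((-184, -78), (-184, -78)), ((-181, 60), (-182, 9)),
     ((225, -75), (1375, -68)), ((-8, -77), (-8, -77)), ((-226, -2208), (-226, -2208)),
     ((-10, -2188), (-10, -2188)), ((-21, 1), (-21, 1)), ((1, -4378), (1, -4378)),
     ((1429, 4), (1429, 4)), ((1, 69), (1, 69)), ((-21, 61), (-21, 61)),
     ((1988, -4007), (1988, -4007))]"

definition base_left :: "nat \<Rightarrow> real ^ 2" where
  "base_left i = pt (fst (base_pairs ! i))"

definition base_right :: "nat \<Rightarrow> real ^ 2" where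
  "base_right i = pt (snd (base_pairs ! i))"

text \<open>Nonvanishing is tested on the left configuration only; equality of signs carries it over
  to the right one.\<close>

lemma base_pairs_iarea:
  "all_triples (\<lambda>(p, p') (q, q') (r, r'). iarea p q r \<noteq> 0 \<and> sgn (iarea p q r) = sgn (iarea p' q' r')) base_pairs"
  by code_simp

lemma base_pairs_snd:
  "all_pairs (\<lambda>(p, p') (q, q'). snd p \<noteq> snd q \<and> sgn (snd p - snd q) = sgn (snd p' - snd q')) base_pairs"
  by code_simp

lemma sgn_of_int_real: "sgn (of_int k :: real) = of_int (sgn k)"
  by (auto simp: sgn_if)

lemma base_area:
  assumes "i < j" "j < l" "l < 16"
  shows "area (base_left i) (base_left j) (base_left l) \<noteq> 0"
    and "sgn (area (base_left i) (base_left j) (base_left l)) = sgn (area (base_right i) (base_right j) (base_right l))"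
proof -
  have "l < length base_pairs" using assms(3) by (simp add: base_pairs_def)
  from all_triples_nth[OF base_pairs_iarea assms(1,2) this]
  show "area (base_left i) (base_left j) (base_left l) \<noteq> 0"
    and "sgn (area (base_left i) (base_left j) (base_left l)) = sgn (area (base_right i) (base_right j) (base_right l))"
    by (auto simp: base_left_def base_right_def area_pt sgn_of_int_real split: prod.splits)
qed

lemma base_snd:
  assumes "i < j" "j < 16"
  shows "base_left i $ 2 \<noteq> base_left j $ 2"
    and "sgn (base_left i $ 2 - base_left j $ 2) = sgn (base_right i $ 2 - base_right j $ 2)"
proof -
  have "j < length base_pairs" using assms(2) by (simp add: base_pairs_def)
  from all_pairs_nth[OF base_pairs_snd assms(1) this]
  show "base_left i $ 2 \<noteq> base_left j $ 2"
    and "sgn (base_left i $ 2 - base_left j $ 2) = sgn (base_right i $ 2 - base_right j $ 2)"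
    by (auto simp: base_left_def base_right_def pt_def sgn_of_int_real simp flip: of_int_diff split: prod.splits)
qed

text \<open>The numerator of \<open>s * d\<^sub>2 - t * d\<^sub>1\<close> in chart coordinates.\<close>

definition separator :: "(nat \<Rightarrow> real ^ 2) \<Rightarrow> real" where
  "separator a =
     area (a 2) (a 0) (a 3) * area (a 0) (a 1) (a 13) * area (a 1) (a 2) (a 12)
   - area (a 0) (a 1) (a 3) * area (a 2) (a 0) (a 12) * area (a 1) (a 2) (a 13)"

lemma separator_base: "separator base_left < 0" "0 < separator base_right"
  by (simp_all add: separator_def base_left_def base_right_def area_pt iarea_def base_pairs_def)

text \<open>The chart sends \<open>Z\<close> to the origin and the line through \<open>X\<close> and
  \<open>Y\<close> to infinity. Lines through \<open>X\<close> become horizontal and lines through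
  \<open>Y\<close> vertical, so areas with these vertices compare \<open>\<eta>\<close> and
  \<open>\<xi>\<close>; areas with vertex \<open>Z\<close> compare directions from the origin. On
  the side where \<open>area X Y\<close> is positive the chart rescales areas by positive factors,
  so orientations survive.\<close>

lemma area_chart:
  fixes Z X Y :: "real ^ 2"
  defines "\<xi> \<equiv> \<lambda>v. area Y Z v / area X Y v" and "\<eta> \<equiv> \<lambda>v. area Z X v / area X Y v"
  assumes Z: "0 < area Z X Y" and uv: "0 < area X Y u" "0 < area X Y v"
  shows "\<eta> u < \<eta> v \<longleftrightarrow> area X u v < 0" "\<eta> v < \<eta> u \<longleftrightarrow> 0 < area X u v"
    and "\<xi> u < \<xi> v \<longleftrightarrow> 0 < area Y u v" "\<xi> v < \<xi> u \<longleftrightarrow> area Y u v < 0"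
    and "\<eta> u * \<xi> v < \<xi> u * \<eta> v \<longleftrightarrow> 0 < area Z u v" "\<xi> u * \<eta> v < \<eta> u * \<xi> v \<longleftrightarrow> area Z u v < 0"
    and "0 < area X Y w \<Longrightarrow>
      0 < (\<xi> v - \<xi> u) * (\<eta> w - \<eta> u) - (\<eta> v - \<eta> u) * (\<xi> w - \<xi> u) \<longleftrightarrow> 0 < area u v w"
    and "0 < area X Y w \<Longrightarrow>
      (\<xi> v - \<xi> u) * (\<eta> w - \<eta> u) - (\<eta> v - \<eta> u) * (\<xi> w - \<xi> u) < 0 \<longleftrightarrow> area u v w < 0"
proof -
  let ?z = "area X Y" and ?D = "area Z X Y"
  have x: "area Y Z v = \<xi> v * ?z v" and y: "area Z X v = \<eta> v * ?z v" if "0 < ?z v" for v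
    using that by (simp_all add: \<xi>_def \<eta>_def)
  note bary = area_barycentric[of Z X Y]
  have pos: "0 < c * d \<longleftrightarrow> 0 < d" "c * d < 0 \<longleftrightarrow> d < 0" if "0 < c" for c d :: real
    using that by (simp_all add: zero_less_mult_iff mult_less_0_iff)
  have "0 < ?z u * ?z v / ?D" using uv Z by simp
  moreover have "area X u v = (?z u * ?z v / ?D) * (\<eta> u - \<eta> v)"
    "area Y u v = (?z u * ?z v / ?D) * (\<xi> v - \<xi> u)"
    "area Z u v = (?z u * ?z v / ?D) * (\<xi> u * \<eta> v - \<eta> u * \<xi> v)"
    using bary(1-3)[of u v] Z by (simp_all add: x y uv field_simps)
  ultimately show "\<eta> u < \<eta> v \<longleftrightarrow> area X u v < 0" "\<eta> v < \<eta> u \<longleftrightarrow> 0 < area X u v"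
    and "\<xi> u < \<xi> v \<longleftrightarrow> 0 < area Y u v" "\<xi> v < \<xi> u \<longleftrightarrow> area Y u v < 0"
    and "\<eta> u * \<xi> v < \<xi> u * \<eta> v \<longleftrightarrow> 0 < area Z u v" "\<xi> u * \<eta> v < \<eta> u * \<xi> v \<longleftrightarrow> area Z u v < 0"
    by (simp_all only: pos diff_gt_0_iff_gt diff_less_0_iff_less)
  assume w: "0 < area X Y w"
  have "0 < ?z u * ?z v * ?z w / ?D\<^sup>2" using uv w Z by simp
  moreover have "area u v w =
      (?z u * ?z v * ?z w / ?D\<^sup>2) * ((\<xi> v - \<xi> u) * (\<eta> w - \<eta> u) - (\<eta> v - \<eta> u) * (\<xi> w - \<xi> u))"
    using bary(4)[of u v w] Z by (simp add: x y uv w field_simps)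
  ultimately show "0 < (\<xi> v - \<xi> u) * (\<eta> w - \<eta> u) - (\<eta> v - \<eta> u) * (\<xi> w - \<xi> u) \<longleftrightarrow> 0 < area u v w"
    "(\<xi> v - \<xi> u) * (\<eta> w - \<eta> u) - (\<eta> v - \<eta> u) * (\<xi> w - \<xi> u) < 0 \<longleftrightarrow> area u v w < 0"
    by (simp_all only: pos)
qed

text \<open>Every realization of the order type, not just the two explicit ones, satisfies the
  hypotheses of \<open>chart_obstruction\<close> once points 0, 1, 2 are used as the frame
  \<open>Z\<close>, \<open>X\<close>, \<open>Y\<close> of the chart.\<close>

lemma separator_nonzero:
  assumes same: "\<And>i j l. i < j \<Longrightarrow> j < l \<Longrightarrow> l < 16 \<Longrightarrow>
    sgn (area (a i) (a j) (a l)) = sgn (area (base_left i) (base_left j) (base_left l))"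
  shows "separator a \<noteq> 0"
proof -
  define \<xi> where "\<xi> = (\<lambda>v. area (a 2) (a 0) v / area (a 1) (a 2) v)"
  define \<eta> where "\<eta> = (\<lambda>v. area (a 0) (a 1) v / area (a 1) (a 2) v)"
  have sgn: "sgn (area (a i) (a j) (a l)) =
      of_int (sgn (iarea (fst (base_pairs ! i)) (fst (base_pairs ! j)) (fst (base_pairs ! l))))"
    if "i < j" "j < l" "l < 16" for i j l
    using same[OF that] by (simp add: base_left_def area_pt sgn_of_int_real)
  have pos: "0 < area (a i) (a j) (a l)" if "i < j" "j < l" "l < 16"
    "0 < iarea (fst (base_pairs ! i)) (fst (base_pairs ! j)) (fst (base_pairs ! l))" for i j l
    using sgn[OF that(1-3)] that(4) by (simp add: sgn_if split: if_splits)
  have neg: "area (a i) (a j) (a l) < 0" if "i < j" "j < l" "l < 16"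
    "iarea (fst (base_pairs ! i)) (fst (base_pairs ! j)) (fst (base_pairs ! l)) < 0" for i j l
    using sgn[OF that(1-3)] that(4) by (simp add: sgn_if split: if_splits)
  have O: "0 < area (a 0) (a 1) (a 2)"
    by (rule pos) (simp_all add: base_pairs_def iarea_def)
  \<comment> \<open>All remaining points lie on the positive side of the line at infinity. Listing
    the indices gives concrete numerals on which the sign can be evaluated.\<close>
  have z: "0 < area (a 1) (a 2) (a v)" if "v \<in> {3..<16}" for v
  proof -
    from that have "v \<in> {3,4,5,6,7,8,9,10,11,12,13,14,15}"
      by simp presburger
    then show ?thesis by (intro pos) (auto simp: base_pairs_def iarea_def)
  qed
  have x: "area (a 2) (a 0) v = - area (a 0) (a 2) v" for v
    by (simp add: area_def algebra_simps)
  \<comment> \<open>Signs are known for increasing indices only; a cyclic shift brings triples such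
    as (10, 11, 9) into that form.\<close>
  have cyc: "area p q r = area r p q" for p q r
    by (simp add: area_def algebra_simps)
  note chart = area_chart[OF O, folded fun_cong[OF \<xi>_def] fun_cong[OF \<eta>_def]]
  note ev = base_pairs_def iarea_def
  have \<xi>pos: "0 < \<xi> (a v)" if "v \<in> {3,6,11,12,13,15}" for v
  proof -
    have "area (a 0) (a 2) (a v) < 0"
      using that by (intro neg) (auto simp: ev)
    moreover have "0 < area (a 1) (a 2) (a v)" using that by (intro z) auto
    ultimately show ?thesis by (simp add: \<xi>_def x zero_less_divide_iff divide_less_0_iff)
  qed
  have \<xi>neg: "0 < - \<xi> (a v)" if "v \<in> {4,5,7,8,9,10,14}" for v
  proof -
    have "0 < area (a 0) (a 2) (a v)"
      using that by (intro pos) (auto simp: ev)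
    moreover have "0 < area (a 1) (a 2) (a v)" using that by (intro z) auto
    ultimately show ?thesis by (simp add: \<xi>_def x zero_less_divide_iff divide_less_0_iff)
  qed
  have \<eta>pos: "0 < \<eta> (a v)" if "v \<in> {3,5,10,12,13,14}" for v
  proof -
    have "0 < area (a 0) (a 1) (a v)"
      using that by (intro pos) (auto simp: ev)
    moreover have "0 < area (a 1) (a 2) (a v)" using that by (intro z) auto
    ultimately show ?thesis by (simp add: \<eta>_def zero_less_divide_iff divide_less_0_iff)
  qed
  have \<eta>neg: "0 < - \<eta> (a v)" if "v \<in> {4,6,7,8,9,11,15}" for v
  proof -
    have "area (a 0) (a 1) (a v) < 0"
      using that by (intro neg) (auto simp: ev)
    moreover have "0 < area (a 1) (a 2) (a v)" using that by (intro z) auto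
    ultimately show ?thesis by (simp add: \<eta>_def zero_less_divide_iff divide_less_0_iff)
  qed
  have "\<xi> (a 3) * \<eta> (a 13) \<noteq> \<eta> (a 3) * \<xi> (a 12)"
  \<comment> \<open>The goal itself determines \<open>s\<close>, \<open>t\<close>,
    \<open>d\<^sub>1\<close>, \<open>d\<^sub>2\<close> from points 3, 12 and 13. The minus signs
    make all parameters positive; the \<open>v\<close> and \<open>w\<close> parameters are the small
    off-axis coordinates of points 10 to 13.\<close>
  proof (rule chart_obstruction[where a = "- \<xi> (a 4)" and b = "- \<eta> (a 4)" and e\<^sub>1 = "- \<xi> (a 5)" and e\<^sub>2 = "\<eta> (a 5)"
      and f\<^sub>1 = "\<xi> (a 6)" and f\<^sub>2 = "- \<eta> (a 6)" and c\<^sub>1 = "- \<xi> (a 7)" and c\<^sub>2 = "- \<eta> (a 7)"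
      and c\<^sub>1' = "- \<xi> (a 8)" and c\<^sub>2' = "- \<eta> (a 8)" and g\<^sub>1 = "- \<xi> (a 9)" and g\<^sub>2 = "- \<eta> (a 9)"
      and h\<^sub>1 = "- \<xi> (a 10)" and v\<^sub>1 = "\<eta> (a 10)" and v\<^sub>2 = "\<xi> (a 11)" and h\<^sub>2 = "- \<eta> (a 11)"
      and w\<^sub>1 = "\<eta> (a 12)" and w\<^sub>2 = "\<xi> (a 13)" and j\<^sub>1 = "- \<xi> (a 14)" and j\<^sub>2 = "\<eta> (a 14)"
      and k\<^sub>1 = "\<xi> (a 15)" and k\<^sub>2 = "- \<eta> (a 15)"])
    show "\<eta> (a 3) < \<eta> (a 5)" by (subst chart; (intro z neg)?; simp add: ev)
    show "\<xi> (a 3) < \<xi> (a 6)" by (subst chart; (intro z pos)?; simp add: ev)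
    show "- \<xi> (a 5) < - \<xi> (a 4)" unfolding neg_less_iff_less by (subst chart; (intro z pos)?; simp add: ev)
    show "- \<eta> (a 6) < - \<eta> (a 4)" unfolding neg_less_iff_less by (subst chart; (intro z neg)?; simp add: ev)
    have "\<eta> (a 5) * \<xi> (a 6) < \<xi> (a 5) * \<eta> (a 6)" by (subst chart; (intro z pos)?; simp add: ev)
    then show "\<xi> (a 6) * \<eta> (a 5) < - \<xi> (a 5) * - \<eta> (a 6)" by (simp add: mult.commute)
    show "- \<eta> (a 4) < - \<eta> (a 7)" unfolding neg_less_iff_less by (subst chart(2); (intro z pos)?; simp add: ev)
    show "- \<xi> (a 7) < - \<xi> (a 9)" unfolding neg_less_iff_less by (subst chart(4); (intro z neg)?; simp add: ev)
    show "- \<xi> (a 4) < - \<xi> (a 8)" unfolding neg_less_iff_less by (subst chart(4); (intro z neg)?; simp add: ev)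
    show "- \<eta> (a 8) < - \<eta> (a 9)" unfolding neg_less_iff_less by (subst chart(2); (intro z pos)?; simp add: ev)
    have "\<eta> (a 7) * \<xi> (a 8) < \<xi> (a 7) * \<eta> (a 8)" by (subst chart(5); (intro z pos)?; simp add: ev)
    then show "- \<xi> (a 8) * - \<eta> (a 7) < - \<xi> (a 7) * - \<eta> (a 8)" by (simp add: mult.commute)
    have "0 < area (a 10) (a 11) (a 9)"
      unfolding cyc[of "a 10"] by (rule pos) (simp_all add: ev)
    then show "(\<xi> (a 11) + - \<xi> (a 10)) * (- (- \<eta> (a 9)) - \<eta> (a 10))
        + (- \<eta> (a 11) + \<eta> (a 10)) * (- \<xi> (a 10) - - \<xi> (a 9)) > 0"
      using chart(7)[OF z z z, of 10 11 9] by (simp add: algebra_simps)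
    show "- \<xi> (a 10) < - \<xi> (a 14)" unfolding neg_less_iff_less by (subst chart(4); (intro z neg)?; simp add: ev)
    show "\<eta> (a 14) < \<eta> (a 13)" by (subst chart(2); (intro z pos)?; simp add: ev)
    show "\<xi> (a 15) < \<xi> (a 12)" by (subst chart(4); (intro z neg)?; simp add: ev)
    show "- \<eta> (a 11) < - \<eta> (a 15)" unfolding neg_less_iff_less by (subst chart(2); (intro z pos)?; simp add: ev)
    have "\<xi> (a 14) * \<eta> (a 15) < \<eta> (a 14) * \<xi> (a 15)" by (subst chart(6); (intro z neg)?; simp add: ev)
    then show "- \<xi> (a 14) * - \<eta> (a 15) < \<xi> (a 15) * \<eta> (a 14)" by (simp add: mult.commute)
    show "\<xi> (a 13) < \<xi> (a 12)" by (subst chart(4); (intro z neg)?; simp add: ev)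
    show "\<eta> (a 12) < \<eta> (a 13)" by (subst chart(1); (intro z neg)?; simp add: ev)
    have "area (a 12) (a 13) (a 3) < 0"
      unfolding cyc[of "a 12"] by (rule neg) (simp_all add: ev)
    then show "(\<xi> (a 13) - \<xi> (a 12)) * (\<eta> (a 3) - \<eta> (a 12))
        - (\<eta> (a 13) - \<eta> (a 12)) * (\<xi> (a 3) - \<xi> (a 12)) < 0"
      using chart(8)[OF z z z, of 12 13 3] by simp
  qed (rule \<xi>pos \<xi>neg \<eta>pos \<eta>neg; simp)+
  \<comment> \<open>Clearing the positive denominators of points 3, 12 and 13 turns the chart
    inequality into the separator.\<close>
  then show ?thesis
    using z[of 3] z[of 12] z[of 13] by (simp add: separator_def \<xi>_def \<eta>_def field_simps)
qed

section \<open>Continuous paths between the two realizations\<close>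

lemma sgn_constant_on_unit_interval:
  fixes h :: "real \<Rightarrow> real"
  assumes cont: "continuous_on {0..1} h" and nz: "\<And>t. t \<in> {0..1} \<Longrightarrow> h t \<noteq> 0" and t: "t \<in> {0..1}"
  shows "sgn (h t) = sgn (h 0)"
proof (rule ccontr)
  assume "sgn (h t) \<noteq> sgn (h 0)"
  then have *: "h 0 \<le> 0 \<and> 0 \<le> h t \<or> h t \<le> 0 \<and> 0 \<le> h 0"
    by (auto simp: sgn_if split: if_splits)
  have "continuous_on {0..t} h"
    using t by (intro continuous_on_subset[OF cont]) auto
  then obtain x where "0 \<le> x" "x \<le> t" "h x = 0"
    using * t IVT'[of h 0 0 t] IVT2'[of h t 0 0] by auto
  then show False using nz[of x] t by auto
qed

lemma continuous_on_area [continuous_intros]: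
  assumes "continuous_on S f" "continuous_on S g" "continuous_on S h"
  shows "continuous_on S (\<lambda>t. area (f t) (g t) (h t))"
  unfolding area_def by (intro continuous_intros assms)

text \<open>Without a collinear triple all orientations stay constant along the path, so the
  separator never vanishes and cannot change sign.\<close>

lemma path_meets_collinear_triple:
  fixes g :: "real \<Rightarrow> nat \<Rightarrow> real ^ 2"
  assumes cont: "\<And>i. i < 16 \<Longrightarrow> continuous_on {0..1} (\<lambda>t. g t i)"
    and start: "\<And>i j l. i < j \<Longrightarrow> j < l \<Longrightarrow> l < 16 \<Longrightarrow>
      sgn (area (g 0 i) (g 0 j) (g 0 l)) = sgn (area (base_left i) (base_left j) (base_left l))"
    and sep: "separator (g 0) < 0" "0 < separator (g 1)"
  obtains t i j l where "t \<in> {0..1}" "i < j" "j < l" "l < 16" "area (g t i) (g t j) (g t l) = 0"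
proof (rule ccontr)
  assume "\<not> thesis"
  with that have nz: "area (g t i) (g t j) (g t l) \<noteq> 0" if "t \<in> {0..1}" "i < j" "j < l" "l < 16" for t i j l
    using that by blast
  have "separator (g t) \<noteq> 0" if t: "t \<in> {0..1}" for t
  proof (rule separator_nonzero)
    fix i j l :: nat assume ijl: "i < j" "j < l" "l < 16"
    have "sgn (area (g t i) (g t j) (g t l)) = sgn (area (g 0 i) (g 0 j) (g 0 l))"
      using ijl nz t by (intro sgn_constant_on_unit_interval continuous_intros cont) auto
    with start[OF ijl] show "sgn (area (g t i) (g t j) (g t l)) = sgn (area (base_left i) (base_left j) (base_left l))"
      by simp
  qed
  moreover have "continuous_on {0..1} (\<lambda>t. separator (g t))"
    unfolding separator_def by (intro continuous_intros cont) auto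
  ultimately have "sgn (separator (g 1)) = sgn (separator (g 0))"
    by (intro sgn_constant_on_unit_interval) auto
  with sep show False by simp
qed

section \<open>Blowing up points into clusters\<close>

text \<open>
  The clusters lie on almost horizontal arcs, so a triple with two points in one cluster is oriented
  by the order of second coordinates, which is the same in both configurations.
\<close>

definition blowup :: "(nat \<Rightarrow> real ^ 2) \<Rightarrow> nat \<Rightarrow> real \<Rightarrow> nat \<Rightarrow> real ^ 2" where
  "blowup b k \<epsilon> v = b (v div k) + vector [\<epsilon> * real (v mod k), (\<epsilon> * real (v mod k))\<^sup>2]"

text \<open>For cluster numbers \<open>p \<le> q \<le> r\<close> the branches are: three clusters,
  first two points together, last two together, all together. The final value 1 reflects that points
  on the arc in increasing order turn left.\<close>

definition blowup_sgn :: "(nat \<Rightarrow> real ^ 2) \<Rightarrow> nat \<Rightarrow> nat \<Rightarrow> nat \<Rightarrow> real" where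
  "blowup_sgn b p q r =
     (if p < q \<and> q < r then sgn (area (b p) (b q) (b r))
      else if q < r then sgn (b r $ 2 - b q $ 2)
      else if p < q then sgn (b p $ 2 - b q $ 2)
      else 1)"

text \<open>For small positive \<epsilon> the sign is that of the leading coefficient, here
  \<open>g 0\<close>.\<close>

lemma eventually_sgn_eq:
  fixes g :: "real \<Rightarrow> real"
  assumes h: "\<And>\<epsilon>. h \<epsilon> = \<epsilon> ^ m * g \<epsilon>" and g: "isCont g 0" "g 0 \<noteq> 0"
  shows "\<forall>\<^sub>F \<epsilon> in at_right 0. sgn (h \<epsilon>) = sgn (g 0)"
proof -
  have lim: "(g \<longlongrightarrow> g 0) (at_right 0)"
    using g(1) by (simp add: isCont_def filterlim_at_split)
  have "\<forall>\<^sub>F \<epsilon> in at_right 0. sgn (g \<epsilon>) = sgn (g 0)"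
  proof (cases "0 < g 0")
    case True
    from order_tendstoD(1)[OF lim this] show ?thesis
      by eventually_elim (use True in simp)
  next
    case False
    with g(2) have "g 0 < 0" by simp
    from order_tendstoD(2)[OF lim this] show ?thesis
      by eventually_elim (use \<open>g 0 < 0\<close> in simp)
  qed
  moreover have "\<forall>\<^sub>F \<epsilon> in at_right 0. (0::real) < \<epsilon>"
    by (simp add: eventually_at_right_less)
  ultimately show ?thesis
    by eventually_elim (simp add: h sgn_mult)
qed

lemma eventually_sgn_area_blowup:
  assumes area: "\<And>i j l. i < j \<Longrightarrow> j < l \<Longrightarrow> l < N \<Longrightarrow> area (b i) (b j) (b l) \<noteq> 0"
    and snd: "\<And>i j. i < j \<Longrightarrow> j < N \<Longrightarrow> b i $ 2 \<noteq> b j $ 2"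
    and ijl: "i < j" "j < l" "l < N * k"
  shows "\<forall>\<^sub>F \<epsilon> in at_right 0. sgn (area (blowup b k \<epsilon> i) (blowup b k \<epsilon> j) (blowup b k \<epsilon> l)) =
      blowup_sgn b (i div k) (j div k) (l div k)"
    and "blowup_sgn b (i div k) (j div k) (l div k) \<noteq> 0"
proof -
  define p q r where "p = i div k" and "q = j div k" and "r = l div k"
  define \<alpha> \<beta> \<gamma> where "\<alpha> = real (i mod k)" and "\<beta> = real (j mod k)" and "\<gamma> = real (l mod k)"
  note defs = p_def q_def r_def \<alpha>_def \<beta>_def \<gamma>_def
  have mod_less: "x mod k < y mod k" if "x < y" "x div k = y div k" for x y
    using that by (metis div_mult_mod_eq nat_add_left_cancel_less)
  have pqr: "p \<le> q" "q \<le> r" "r < N"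
    using ijl by (auto simp: defs div_le_mono less_mult_imp_div_less)
  have bl: "blowup b k \<epsilon> i = b p + vector [\<epsilon> * \<alpha>, (\<epsilon> * \<alpha>)\<^sup>2]"
    "blowup b k \<epsilon> j = b q + vector [\<epsilon> * \<beta>, (\<epsilon> * \<beta>)\<^sup>2]"
    "blowup b k \<epsilon> l = b r + vector [\<epsilon> * \<gamma>, (\<epsilon> * \<gamma>)\<^sup>2]" for \<epsilon>
    by (simp_all add: blowup_def defs)
  let ?A = "\<lambda>\<epsilon>. area (blowup b k \<epsilon> i) (blowup b k \<epsilon> j) (blowup b k \<epsilon> l)"
  have ev: "(\<forall>\<^sub>F \<epsilon> in at_right 0. sgn (?A \<epsilon>) = blowup_sgn b p q r) \<and> blowup_sgn b p q r \<noteq> 0"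
  proof -
    consider "p < q" "q < r" | "p = q" "q < r" | "p < q" "q = r" | "p = q" "q = r"
      using pqr by linarith
    then show ?thesis
    proof cases
      case 1
      then have "area (b p) (b q) (b r) \<noteq> 0" using pqr area by simp
      moreover have "isCont ?A 0"
        unfolding bl area_def by simp
      moreover have "?A 0 = area (b p) (b q) (b r)"
        by (simp add: bl area_def)
      ultimately show ?thesis
        using 1 eventually_sgn_eq[of ?A 0 ?A] by (simp add: blowup_sgn_def sgn_zero_iff)
    next
      case 2
      then have "\<alpha> < \<beta>" using mod_less[of i j] ijl by (simp add: defs)
      \<comment> \<open>One power of \<epsilon> comes from the difference within the cluster. That
        difference is horizontal to first order, so \<open>?g 0\<close> sees only second
        coordinates.\<close>
      let ?g = "\<lambda>\<epsilon>. (\<beta> - \<alpha>) * ((b r $ 2 + (\<epsilon> * \<gamma>)\<^sup>2 - b q $ 2 - (\<epsilon> * \<alpha>)\<^sup>2)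
          - \<epsilon> * (\<beta> + \<alpha>) * (b r $ 1 + \<epsilon> * \<gamma> - b q $ 1 - \<epsilon> * \<alpha>))"
      have "?A \<epsilon> = \<epsilon> ^ 1 * ?g \<epsilon>" for \<epsilon>
        using 2 by (simp add: bl area_def power2_eq_square algebra_simps)
      moreover have "isCont ?g 0" by simp
      moreover have "?g 0 \<noteq> 0" using \<open>\<alpha> < \<beta>\<close> snd[of q r] 2 pqr by simp
      ultimately have "\<forall>\<^sub>F \<epsilon> in at_right 0. sgn (?A \<epsilon>) = sgn (?g 0)"
        by (rule eventually_sgn_eq)
      with 2 \<open>\<alpha> < \<beta>\<close> \<open>?g 0 \<noteq> 0\<close> show ?thesis by (simp add: blowup_sgn_def sgn_mult sgn_zero_iff)
    next
      case 3
      then have "\<beta> < \<gamma>" using mod_less[of j l] ijl by (simp add: defs)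
      let ?g = "\<lambda>\<epsilon>. (\<gamma> - \<beta>) * (\<epsilon> * (\<gamma> + \<beta>) * (b q $ 1 + \<epsilon> * \<beta> - b p $ 1 - \<epsilon> * \<alpha>)
          - (b q $ 2 + (\<epsilon> * \<beta>)\<^sup>2 - b p $ 2 - (\<epsilon> * \<alpha>)\<^sup>2))"
      have "?A \<epsilon> = \<epsilon> ^ 1 * ?g \<epsilon>" for \<epsilon>
        using 3 by (simp add: bl area_def power2_eq_square algebra_simps)
      moreover have "isCont ?g 0" by simp
      moreover have "?g 0 \<noteq> 0" using \<open>\<beta> < \<gamma>\<close> snd[of p q] 3 pqr by simp
      ultimately have "\<forall>\<^sub>F \<epsilon> in at_right 0. sgn (?A \<epsilon>) = sgn (?g 0)"
        by (rule eventually_sgn_eq)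
      with 3 \<open>\<beta> < \<gamma>\<close> \<open>?g 0 \<noteq> 0\<close> show ?thesis by (simp add: blowup_sgn_def sgn_mult sgn_zero_iff)
    next
      case 4
      then have less: "\<alpha> < \<beta>" "\<beta> < \<gamma>"
        using mod_less[of i j] mod_less[of j l] ijl by (simp_all add: defs)
      \<comment> \<open>Three points on a parabola span a Vandermonde determinant, homogeneous of
        degree 3 in \<epsilon>.\<close>
      let ?g = "\<lambda>\<epsilon>::real. (\<beta> - \<alpha>) * (\<gamma> - \<alpha>) * (\<gamma> - \<beta>)"
      have "?A \<epsilon> = \<epsilon> ^ 3 * ?g \<epsilon>" for \<epsilon>
        using 4 by (simp add: bl area_def power2_eq_square power3_eq_cube algebra_simps)
      moreover have "isCont ?g 0" by simp
      moreover have "?g 0 \<noteq> 0" using less by simp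
      ultimately have "\<forall>\<^sub>F \<epsilon> in at_right 0. sgn (?A \<epsilon>) = sgn (?g 0)"
        by (rule eventually_sgn_eq)
      with 4 less show ?thesis by (simp add: blowup_sgn_def sgn_mult sgn_zero_iff)
    qed
  qed
  from ev show "\<forall>\<^sub>F \<epsilon> in at_right 0. sgn (?A \<epsilon>) = blowup_sgn b (i div k) (j div k) (l div k)"
    and "blowup_sgn b (i div k) (j div k) (l div k) \<noteq> 0"
    by (simp_all add: p_def q_def r_def)
qed

section \<open>Counting transversals\<close>

text \<open>A choice \<open>c\<close> stands for the points \<open>i * k + c i\<close>, one per
  cluster; extensionality makes the number of choices exactly \<open>k ^ N\<close>.\<close>

definition transversals :: "nat \<Rightarrow> nat \<Rightarrow> (nat \<Rightarrow> nat) set" where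
  "transversals N k = {..<N} \<rightarrow>\<^sub>E {..<k}"

text \<open>Division by \<open>k\<close> recovers cluster and position of each entry of
  \<open>\<tau>\<close>, so the triple fixes the choice at three places and leaves at most
  \<open>k\<close> options at each of the others.\<close>

lemma card_transversals_through:
  "card {c \<in> transversals N k. \<exists>i j l. i < j \<and> j < l \<and> l < N \<and>
     (i * k + c i, j * k + c j, l * k + c l) = \<tau>} \<le> k ^ (N - 3)"
    (is "card ?C \<le> _")
proof (cases "?C = {}")
  case True
  then show ?thesis by (metis card.empty le0)
next
  case False
  then obtain c i j l where c: "c \<in> transversals N k" and ijl: "i < j" "j < l" "l < N"
    and \<tau>: "\<tau> = (i * k + c i, j * k + c j, l * k + c l)"
    by auto
  define S where "S = {i, j, l}"
  let ?F = "\<lambda>x. if x \<in> S then {c x} else {..<k}"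
  have "?C \<subseteq> PiE {..<N} ?F"
  proof
    fix c' assume "c' \<in> ?C"
    then obtain i' j' l' where c': "c' \<in> transversals N k" and ijl': "i' < j'" "j' < l'" "l' < N"
      and eq: "i' * k + c' i' = i * k + c i" "j' * k + c' j' = j * k + c j" "l' * k + c' l' = l * k + c l"
      by (auto simp: \<tau>)
    have digits: "x' = x \<and> c' x = c x" if "x' < N" "x < N" "x' * k + c' x' = x * k + c x" for x x'
    proof -
      have "c' x' < k" "c x < k" using that c c' by (auto simp: transversals_def)
      with arg_cong[OF that(3), of "\<lambda>v. v div k"] have "x' = x" by simp
      with that(3) show ?thesis by simp
    qed
    have "c' x = c x" if "x \<in> S" for x
      using that digits[OF _ _ eq(1)] digits[OF _ _ eq(2)] digits[OF _ _ eq(3)] ijl ijl'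
      by (auto simp: S_def)
    with c' show "c' \<in> PiE {..<N} ?F"
      by (auto simp: transversals_def PiE_iff)
  qed
  then have "card ?C \<le> card (PiE {..<N} ?F)"
    by (intro card_mono finite_PiE) auto
  also have "\<dots> = (\<Prod>x<N. if x \<in> S then 1 else k)"
    by (simp add: card_PiE if_distrib cong: if_cong)
  also have "\<dots> = k ^ card ({..<N} - S)"
    by (simp add: prod.If_cases Diff_eq)
  also have "card ({..<N} - S) = N - 3"
    using ijl by (subst card_Diff_subset) (auto simp: S_def)
  finally show ?thesis .
qed

text \<open>Double counting: the degenerate times cover all \<open>k ^ N\<close> transversals, and
  the single collinear triple at such a time accounts for at most \<open>k ^ (N - 3)\<close> of
  them.\<close>

lemma motion_cost_ge:
  assumes m: "motion n P P' m" and N: "3 \<le> N" and k: "0 < k"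
    and hit: "\<And>c. c \<in> transversals N k \<Longrightarrow> \<exists>t\<in>{0..1}. \<exists>i j l. i < j \<and> j < l \<and> l < N \<and>
        (i * k + c i, j * k + c j, l * k + c l) \<in> collinear_triples n (m t)"
  shows "k ^ 3 \<le> motion_cost n m"
proof -
  define D where "D = degenerate_times n m"
  have D: "finite D" and one: "\<And>t. t \<in> D \<Longrightarrow> card (collinear_triples n (m t)) = 1"
    using m by (auto simp: motion_def D_def)
  define F where "F = (\<lambda>t. {c \<in> transversals N k. \<exists>i j l. i < j \<and> j < l \<and> l < N \<and>
     (i * k + c i, j * k + c j, l * k + c l) \<in> collinear_triples n (m t)})"
  have fin: "finite (transversals N k)"
    by (auto simp: transversals_def intro: finite_PiE)
  have cardF: "card (F t) \<le> k ^ (N - 3)" if t: "t \<in> D" for t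
  proof -
    obtain \<tau> where "collinear_triples n (m t) = {\<tau>}"
      using one[OF t] by (auto simp: card_1_singleton_iff)
    then show ?thesis
      using card_transversals_through[of N k \<tau>] by (simp add: F_def)
  qed
  have "transversals N k \<subseteq> (\<Union>t\<in>D. F t)"
  proof
    fix c assume c: "c \<in> transversals N k"
    from hit[OF c] obtain t i j l where t: "t \<in> {0..1}" and ijl: "i < j" "j < l" "l < N"
      and col: "(i * k + c i, j * k + c j, l * k + c l) \<in> collinear_triples n (m t)"
      by blast
    from col have "\<not> general_position n (m t)"
      by (force simp: collinear_triples_def general_position_def)
    with t have "t \<in> D" by (simp add: D_def degenerate_times_def)
    moreover have "c \<in> F t" using c ijl col by (auto simp: F_def)
    ultimately show "c \<in> (\<Union>t\<in>D. F t)" by blast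
  qed
  then have "card (transversals N k) \<le> card (\<Union>t\<in>D. F t)"
    using D fin by (intro card_mono) (auto simp: F_def)
  also have "\<dots> \<le> (\<Sum>t\<in>D. card (F t))"
    by (rule card_UN_le[OF D])
  also have "\<dots> \<le> (\<Sum>t\<in>D. k ^ (N - 3))"
    by (rule sum_mono[OF cardF])
  finally have "k ^ N \<le> card D * k ^ (N - 3)"
    by (simp add: transversals_def card_PiE)
  moreover have "k ^ N = k ^ 3 * k ^ (N - 3)"
    using N by (simp flip: power_add)
  ultimately show ?thesis
    using k by (simp add: motion_cost_def D_def)
qed

section \<open>The two blown-up configurations and the final bound\<close>

lemma base_right_blowup:
  shows "i < j \<Longrightarrow> j < l \<Longrightarrow> l < 16 \<Longrightarrow> area (base_right i) (base_right j) (base_right l) \<noteq> 0"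
    and "i < j \<Longrightarrow> j < 16 \<Longrightarrow> base_right i $ 2 \<noteq> base_right j $ 2"
    and "p \<le> q \<Longrightarrow> q \<le> r \<Longrightarrow> r < 16 \<Longrightarrow> blowup_sgn base_right p q r = blowup_sgn base_left p q r"
proof -
  show "area (base_right i) (base_right j) (base_right l) \<noteq> 0" if "i < j" "j < l" "l < 16"
    using base_area[OF that] by (auto simp: sgn_zero_iff)
  show "base_right i $ 2 \<noteq> base_right j $ 2" if "i < j" "j < 16"
    using base_snd[OF that] by (metis right_minus_eq sgn_zero_iff)
  \<comment> \<open>\<open>blowup_sgn\<close> takes height differences in both directions, while
    \<open>base_snd\<close> subtracts the later point from the earlier one only.\<close>
  have flip: "sgn (x - y) = - sgn (y - x)" for x y :: real
    by (simp add: sgn_if)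
  show "blowup_sgn base_right p q r = blowup_sgn base_left p q r" if "p \<le> q" "q \<le> r" "r < 16"
    using that base_area(2)[of p q r] base_snd(2)[of p q] base_snd(2)[of q r]
      flip[of "base_left r $ 2" "base_left q $ 2"] flip[of "base_right r $ 2" "base_right q $ 2"]
    by (auto simp: blowup_sgn_def)
qed

lemma separator_cong:
  assumes "\<And>i. i < 16 \<Longrightarrow> a i = a' i"
  shows "separator a = separator a'"
  unfolding separator_def by (simp add: assms)

lemma isCont_separator_blowup: "isCont (\<lambda>\<epsilon>. separator (\<lambda>i. blowup b k \<epsilon> (s i))) 0"
  unfolding separator_def area_def blowup_def by simp

lemma separator_blowup_0:
  assumes "c \<in> transversals 16 k"
  shows "separator (\<lambda>i. blowup b k 0 (i * k + c i)) = separator b"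
proof (rule separator_cong)
  fix i :: nat assume "i < 16"
  then have "c i < k" using assms by (auto simp: transversals_def)
  then show "blowup b k 0 (i * k + c i) = b i" by (simp add: blowup_def vec_eq_iff forall_2)
qed

text \<open>At \<epsilon> = 0 every cluster collapses to its base point, so continuity transfers the
  strict signs of \<open>separator_base\<close> to each transversal.\<close>

lemma eventually_separator_blowup:
  assumes c: "c \<in> transversals 16 k"
  shows "\<forall>\<^sub>F \<epsilon> in at_right 0. separator (\<lambda>i. blowup base_left k \<epsilon> (i * k + c i)) < 0"
    and "\<forall>\<^sub>F \<epsilon> in at_right 0. 0 < separator (\<lambda>i. blowup base_right k \<epsilon> (i * k + c i))"
proof -
  have "((\<lambda>\<epsilon>. separator (\<lambda>i. blowup b k \<epsilon> (i * k + c i))) \<longlongrightarrow> separator b) (at_right 0)" for b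
    using isCont_separator_blowup[of b k "\<lambda>i. i * k + c i"] separator_blowup_0[OF c, of b]
    by (simp add: isCont_def filterlim_at_split)
  from order_tendstoD[OF this] separator_base
  show "\<forall>\<^sub>F \<epsilon> in at_right 0. separator (\<lambda>i. blowup base_left k \<epsilon> (i * k + c i)) < 0"
    and "\<forall>\<^sub>F \<epsilon> in at_right 0. 0 < separator (\<lambda>i. blowup base_right k \<epsilon> (i * k + c i))"
    by blast+
qed

lemma finite_triples: "finite (triples n)"
  by (rule finite_subset[of _ "{..<n} \<times> {..<n} \<times> {..<n}"]) (auto simp: triples_def)

theorem theorem4:
  "\<forall>N::nat. \<exists>n\<ge>N. \<exists>P P' :: nat \<Rightarrow> real ^ 2.
     general_position n P \<and> general_position n P' \<and>
     order_type n P = order_type n P' \<and>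
     ereal_of_enat (motion_dist n P P') \<ge> ereal (10 powi (-4) * real (n choose 3))"
proof
  fix N :: nat
  \<comment> \<open>The successor yields both \<open>k > 0\<close> and
    \<open>16 * k \<ge> N\<close>.\<close>
  define k where "k = Suc N"
  define n where "n = 16 * k"
  define \<sigma> where "\<sigma> = (\<lambda>(i, j, l). blowup_sgn base_left (i div k) (j div k) (l div k))"
  have \<sigma>: "\<forall>\<^sub>F \<epsilon> in at_right 0. \<forall>(i, j, l) \<in> triples n.
      sgn (area (blowup b k \<epsilon> i) (blowup b k \<epsilon> j) (blowup b k \<epsilon> l)) = \<sigma> (i, j, l)"
    if "b = base_left \<or> b = base_right" for b
  proof (intro eventually_ball_finite finite_triples ballI, clarify)
    fix i j l assume "(i, j, l) \<in> triples n"
    then have ijl: "i < j" "j < l" "l < 16 * k" by (auto simp: triples_def n_def)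
    then have "blowup_sgn b (i div k) (j div k) (l div k) = \<sigma> (i, j, l)"
      using that base_right_blowup(3)[of "i div k" "j div k" "l div k"]
      by (auto simp: \<sigma>_def div_le_mono less_mult_imp_div_less)
    moreover have "\<forall>\<^sub>F \<epsilon> in at_right 0. sgn (area (blowup b k \<epsilon> i) (blowup b k \<epsilon> j) (blowup b k \<epsilon> l)) =
        blowup_sgn b (i div k) (j div k) (l div k)"
      using that by (intro eventually_sgn_area_blowup(1)[OF _ _ ijl])
        (auto simp: base_area base_snd base_right_blowup)
    ultimately show "\<forall>\<^sub>F \<epsilon> in at_right 0.
        sgn (area (blowup b k \<epsilon> i) (blowup b k \<epsilon> j) (blowup b k \<epsilon> l)) = \<sigma> (i, j, l)"
      by simp
  qed
  have \<sigma>_nz: "\<sigma> \<tau> \<noteq> 0" if "\<tau> \<in> triples n" for \<tau>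
    using that eventually_sgn_area_blowup(2)[of 16 base_left _ _ _ k] base_area(1) base_snd(1)
    by (auto simp: \<sigma>_def triples_def n_def)
  have fin: "finite (transversals 16 k)"
    by (auto simp: transversals_def intro: finite_PiE)
  have "\<forall>\<^sub>F \<epsilon> in at_right 0. \<forall>c\<in>transversals 16 k.
      separator (\<lambda>i. blowup base_left k \<epsilon> (i * k + c i)) < 0 \<and> 0 < separator (\<lambda>i. blowup base_right k \<epsilon> (i * k + c i))"
    by (intro eventually_ball_finite fin ballI eventually_conj eventually_separator_blowup)
  \<comment> \<open>There are finitely many triples and transversals, so one \<epsilon> meets all
    the conditions. The same \<open>\<sigma>\<close> serves both configurations, which gives equal
    order types.\<close>
  with \<sigma>[of base_left] \<sigma>[of base_right] have "\<forall>\<^sub>F \<epsilon> in at_right (0::real).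
      (\<forall>b\<in>{base_left, base_right}. \<forall>(i, j, l) \<in> triples n.
        sgn (area (blowup b k \<epsilon> i) (blowup b k \<epsilon> j) (blowup b k \<epsilon> l)) = \<sigma> (i, j, l)) \<and>
      (\<forall>c\<in>transversals 16 k. separator (\<lambda>i. blowup base_left k \<epsilon> (i * k + c i)) < 0 \<and>
        0 < separator (\<lambda>i. blowup base_right k \<epsilon> (i * k + c i)))"
    by (simp add: eventually_conj_iff)
  from eventually_happens'[OF trivial_limit_at_right_real this] obtain \<epsilon> where
    \<epsilon>: "\<And>b i j l. b \<in> {base_left, base_right} \<Longrightarrow> (i, j, l) \<in> triples n \<Longrightarrow>
        sgn (area (blowup b k \<epsilon> i) (blowup b k \<epsilon> j) (blowup b k \<epsilon> l)) = \<sigma> (i, j, l)"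
    and sep: "\<And>c. c \<in> transversals 16 k \<Longrightarrow> separator (\<lambda>i. blowup base_left k \<epsilon> (i * k + c i)) < 0"
      "\<And>c. c \<in> transversals 16 k \<Longrightarrow> 0 < separator (\<lambda>i. blowup base_right k \<epsilon> (i * k + c i))"
    by fast
  define P P' where "P = blowup base_left k \<epsilon>" and "P' = blowup base_right k \<epsilon>"
  have gp: "general_position n P" "general_position n P'"
    using \<epsilon>[of base_left] \<epsilon>[of base_right] \<sigma>_nz
    by (auto simp: general_position_def collinear_iff_area P_def P'_def) (metis sgn_0)+
  have ot: "order_type n P = order_type n P'"
    using \<epsilon>[of base_left] \<epsilon>[of base_right]
    by (auto simp: order_type_def orientation_eq_sgn_area P_def P'_def restrict_def fun_eq_iff)
  have cost: "k ^ 3 \<le> motion_cost n m" if m: "motion n P P' m" for m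
  proof (rule motion_cost_ge[OF m])
    fix c assume c: "c \<in> transversals 16 k"
    have c_less: "c i < k" if "i < 16" for i
      using c that by (auto simp: transversals_def)
    have div_eq: "(i * k + c i) div k = i" if "i < 16" for i
      using c_less[OF that] by simp
    have idx: "i * k + c i < j * k + c j" if "i < j" "j < 16" for i j
    proof -
      have "i * k + c i < Suc i * k" using c_less[of i] that by simp
      also have "\<dots> \<le> j * k" using that by (intro mult_le_mono1) simp
      finally show ?thesis by simp
    qed
    have idx_n: "i * k + c i < n" if "i < 16" for i
    proof -
      have "i * k + c i < Suc i * k" using c_less[of i] that by simp
      also have "\<dots> \<le> n" using that unfolding n_def by (intro mult_le_mono1) simp
      finally show ?thesis .
    qed
    have trip: "(i * k + c i, j * k + c j, l * k + c l) \<in> triples n" if "i < j" "j < l" "l < 16" for i j l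
      using that idx idx_n by (simp add: triples_def)
    have m01: "m 0 (i * k + c i) = P (i * k + c i)" "m 1 (i * k + c i) = P' (i * k + c i)" if "i < 16" for i
      using m idx_n[OF that] by (auto simp: motion_def)
    obtain t i j l where "t \<in> {0..1}" "i < j" "j < l" "l < 16"
      "area (m t (i * k + c i)) (m t (j * k + c j)) (m t (l * k + c l)) = 0"
    proof (rule path_meets_collinear_triple[of "\<lambda>t i. m t (i * k + c i)"])
      show "continuous_on {0..1} (\<lambda>t. m t (i * k + c i))" if "i < 16" for i
        using m idx_n[OF that] by (simp add: motion_def)
      show "sgn (area (m 0 (i * k + c i)) (m 0 (j * k + c j)) (m 0 (l * k + c l))) =
          sgn (area (base_left i) (base_left j) (base_left l))" if "i < j" "j < l" "l < 16" for i j l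
        \<comment> \<open>The three points lie in different clusters, so \<open>\<sigma>\<close> is
          the orientation of the base points there.\<close>
        using that \<epsilon>[OF _ trip[OF that], of base_left]
        by (simp add: m01 P_def \<sigma>_def div_eq blowup_sgn_def)
      show "separator (\<lambda>i. m 0 (i * k + c i)) < 0"
        using sep(1)[OF c] by (subst separator_cong[OF m01(1)]) (simp_all add: P_def)
      show "0 < separator (\<lambda>i. m 1 (i * k + c i))"
        using sep(2)[OF c] by (subst separator_cong[OF m01(2)]) (simp_all add: P'_def)
    qed blast
    then show "\<exists>t\<in>{0..1}. \<exists>i j l. i < j \<and> j < l \<and> l < 16 \<and>
        (i * k + c i, j * k + c j, l * k + c l) \<in> collinear_triples n (m t)"
      using trip by (auto simp: collinear_triples_def collinear_iff_area intro!: bexI exI)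
  qed (simp_all add: k_def)
  then have "enat (k ^ 3) \<le> motion_dist n P P'"
    by (auto simp: motion_dist_def intro!: Inf_greatest)
  then have "ereal (real (k ^ 3)) \<le> ereal_of_enat (motion_dist n P P')"
    by (metis ereal_of_enat_le_iff ereal_of_enat_simps(1))
  moreover have "10 powi (-4) * real (n choose 3) \<le> real (k ^ 3)"
  proof -
    have "real (n choose 3) \<le> real (n ^ 3)"
      unfolding of_nat_le_iff by (rule binomial_le_pow) (simp add: n_def k_def)
    \<comment> \<open>Here \<open>n ^ 3 = 4096 * k ^ 3\<close>, which is below
      \<open>10 ^ 4 * k ^ 3\<close>; this is where the constant comes from.\<close>
    then show ?thesis by (simp add: n_def power_mult_distrib power_int_minus)
  qed
  ultimately have "ereal (10 powi (-4) * real (n choose 3)) \<le> ereal_of_enat (motion_dist n P P')"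
    by (meson ereal_less_eq(3) order_trans)
  moreover have "N \<le> n" by (simp add: n_def k_def)
  ultimately show "\<exists>n\<ge>N. \<exists>P P' :: nat \<Rightarrow> real ^ 2.
     general_position n P \<and> general_position n P' \<and> order_type n P = order_type n P' \<and>
     ereal_of_enat (motion_dist n P P') \<ge> ereal (10 powi (-4) * real (n choose 3))"
    using gp ot by blast
qed

end
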